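(* Assume that the network system (N) is $L^q$-approximately controllable (in some time $T>0$) for some $q\in[1,\infty)$. Then the directed graph $\mathcal{G}$ must be the finite union of directed cycle graphs.
   Context: Graph. $\mathcal{G}=(\mathcal{V},\mathcal{E})$ is a directed graph with vertices $\mathcal{V}=\{v_1,\dots,v_k\}$ and edges $\mathcal{E}=\{\varepsilon_1,\dots,\varepsilon_n\}$; each edge $\varepsilon_j$ is oriented from its endpoint $\varepsilon_j(1)\in\mathcal{V}$ to its endpoint $\varepsilon_j(0)\in\mathcal{V}$ (it is an outgoing edge of $\varepsilon_j(1)$ and an incoming edge of $\varepsilon_j(0)$). Standing assumption: every vertex has at least one outgoing and at least one incoming edge. The union in the conclusion is a disjoint union; a directed cycle graph may have a single edge (a loop). Data. The $k\times n$ matrices $\mathcal{I}^-=(i^-_{ij})$ and $\mathcal{I}^+=(i^+_{ij})$ are defined by $i^-_{ij}=1$ if $v_i=\varepsilon_j(1)$ and $0$ otherwise, $i^+_{ij}=1$ if $v_i=\varepsilon_j(0)$ and $0$ otherwise. Weights $w^-_{ij}\in[0,1]$, $i\in\{1,\dots,k\}$, $j\in\{1,\dots,n\}$, are given with $\sum_{j=1}^nw^-_{ij}=1$ for every $i$, and $w^-_{ij}=0$ if and only if $i^-_{ij}=0$; $\mathcal{I}^-_w=(w^-_{ij})$. $\Gamma=(\gamma_{il})$ is a real $k\times m$ matrix. For $j\in\{1,\dots,n\}$, $d_j\in L^1([0,1],\mathbb{R})$, $\lambda_j$ is negative on $[0,1]$, and $\lambda_j,\frac1{\lambda_j}\in L^\infty([0,1],\mathbb{R})$.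 Network system (N). For unknown $z=(z_1,\dots,z_n)^T$ and control $u=(u_1,\dots,u_m)^T$, $$\partial_tz_j(t,x)+\lambda_j(x)\partial_xz_j(t,x)+d_j(x)z_j(t,x)=0,\quad t>0,\ x\in(0,1),$$ $$i^-_{ij}z_j(t,1)=w^-_{ij}\sum_{e=1}^ni^+_{ie}z_e(t,0)+w^-_{ij}\sum_{l=1}^m\gamma_{il}u_l(t),\quad i\in\{1,\dots,k\},\ j\in\{1,\dots,n\};$$ the second line is equivalent to $z(t,1)=(\mathcal{I}^-_w)^T\mathcal{I}^+z(t,0)+(\mathcal{I}^-_w)^T\Gamma u(t)$. Solutions. For $T>0$, $z:[0,T]\times[0,1]\to\mathbb{R}^n$ is a solution of (N) with initial condition $\bar z$ and control $u$ if $z(0,\cdot)=\bar z$, the boundary condition holds for $t\in[0,T]$, and $z_j\big(t+\int_x^{x+h}\frac{d\xi}{\lambda_j(\xi)},x+h\big)=e^{-\int_x^{x+h}\frac{d_j(\xi)}{\lambda_j(\xi)}d\xi}z_j(t,x)$ for all $j$, $t\in[0,T]$, $x\in[0,1]$ and $h\in\mathbb{R}$ with $t+\int_x^{x+h}\frac{d\xi}{\lambda_j(\xi)}\in[0,T]$ and $x+h\in[0,1]$. For $L^q$ data, functions are identified when equal almost everywhere; in this sense, for $\bar z\in L^q$ and $u\in L^q$ there is a unique solution, and $z(t,\cdot)\in L^q$ for all $t$. Controllability. (N) is $L^q$-approximately controllable in time $T$ if for every $\epsilon>0$ and $\phi,\psi\in L^q([0,1],\mathbb{R}^n)$ there is $u\in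 L^q([0,T],\mathbb{R}^m)$ such that the solution $z$ with initial condition $\phi$ and control $u$ satisfies $\|z(T,\cdot)-\psi\|_{L^q([0,1])}<\epsilon$. *)

theory Defs
  imports "HOL-Analysis.Analysis" "Graph_Theory.Digraph_Component"
begin

text \<open>A directed cycle graph consists of nothing but the arcs and the vertices of one cycle; a
  single vertex with a loop and two opposite arcs between two vertices are included.\<close>

definition directed_cycle_graph :: "('a, 'b) pre_digraph \<Rightarrow> bool" where
  "directed_cycle_graph C \<longleftrightarrow>
     (\<exists>p. pre_digraph.cycle C p \<and> arcs C = set p \<and> verts C = tail C ` set p)"

definition disjoint_union_of :: "('a, 'b) pre_digraph \<Rightarrow> ('a, 'b) pre_digraph set \<Rightarrow> bool" where
  "disjoint_union_of G \<C> \<longleftrightarrow>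
     (\<forall>C\<in>\<C>. subgraph C G) \<and>
     pairwise (\<lambda>C D. verts C \<inter> verts D = {} \<and> arcs C \<inter> arcs D = {}) \<C> \<and>
     G = pre_digraph.Union G \<C>"

text \<open>An edge is oriented from its tail \<open>\<epsilon>\<^sub>j(1)\<close> to its head \<open>\<epsilon>\<^sub>j(0)\<close>. Rows are indexed by vertices
  and columns by edges.\<close>

definition outgoing_incidence :: "('k::finite, 'n::finite) pre_digraph \<Rightarrow> real^'n^'k" where
  "outgoing_incidence G = (\<chi> i j. if i = tail G j then 1 else 0)"

definition incoming_incidence :: "('k::finite, 'n::finite) pre_digraph \<Rightarrow> real^'n^'k" where
  "incoming_incidence G = (\<chi> i j. if i = head G j then 1 else 0)"

text \<open>The spaces below consist of representatives rather than of equivalence classes, and use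
  Lebesgue (not only Borel) measurability.\<close>

definition Lq :: "real \<Rightarrow> real \<Rightarrow> real \<Rightarrow> (real \<Rightarrow> 'a::euclidean_space) set" where
  "Lq q a b = {f. f \<in> borel_measurable (lebesgue_on {a..b}) \<and>
                  integrable (lebesgue_on {a..b}) (\<lambda>x. norm (f x) powr q)}"

definition Lq_norm :: "real \<Rightarrow> real \<Rightarrow> real \<Rightarrow> (real \<Rightarrow> 'a::euclidean_space) \<Rightarrow> real" where
  "Lq_norm q a b f = (LINT x|lebesgue_on {a..b}. norm (f x) powr q) powr (1 / q)"

definition Linf :: "real \<Rightarrow> real \<Rightarrow> (real \<Rightarrow> real) set" where
  "Linf a b = {f. f \<in> borel_measurable (lebesgue_on {a..b}) \<and>
                  (\<exists>B. AE x in lebesgue_on {a..b}. \<bar>f x\<bar> \<le> B)}"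

text \<open>Oriented integral, negative of the integral over \<open>[b,a]\<close> if \<open>b < a\<close>. It is taken with
  respect to \<open>lebesgue\<close> since \<open>LBINT\<close> yields 0 for integrands that are not Borel measurable.\<close>

abbreviation oriented_integral :: "real \<Rightarrow> real \<Rightarrow> (real \<Rightarrow> real) \<Rightarrow> real" where
  "oriented_integral a b f \<equiv> interval_lebesgue_integral lebesgue (ereal a) (ereal b) f"

text \<open>\<open>z t x $ j\<close> is the state on edge \<open>j\<close>. The data \<open>\<phi>\<close> and \<open>u\<close> are classes modulo null sets, so the
  initial and boundary conditions are required almost everywhere. The identity along the
  characteristics holds everywhere: it determines \<open>z\<close> from its values on the parts \<open>t = 0\<close> and
  \<open>x = 1\<close> of the boundary, and, as the travel time is bi-Lipschitz, changing those values on null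
  sets changes each \<open>z t\<close> only on a null set. Hence \<open>z T\<close> is unique almost everywhere.\<close>

definition network_solution ::
  "('k::finite, 'n::finite) pre_digraph \<Rightarrow> real^'n^'k \<Rightarrow> real^'m::finite^'k \<Rightarrow>
   ('n \<Rightarrow> real \<Rightarrow> real) \<Rightarrow> ('n \<Rightarrow> real \<Rightarrow> real) \<Rightarrow> real \<Rightarrow>
   (real \<Rightarrow> real^'n) \<Rightarrow> (real \<Rightarrow> real^'m) \<Rightarrow> (real \<Rightarrow> real \<Rightarrow> real^'n) \<Rightarrow> bool" where
  "network_solution G w \<Gamma> lam d T \<phi> u z \<longleftrightarrow>
     (AE x in lebesgue_on {0..1}. z 0 x = \<phi> x) \<and>
     (AE t in lebesgue_on {0..T}. \<forall>i j.
        outgoing_incidence G $ i $ j * z t 1 $ j =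
          w $ i $ j * (\<Sum>e\<in>UNIV. incoming_incidence G $ i $ e * z t 0 $ e)
          + w $ i $ j * (\<Sum>l\<in>UNIV. \<Gamma> $ i $ l * u t $ l)) \<and>
     (\<forall>j. \<forall>t\<in>{0..T}. \<forall>x\<in>{0..1}. \<forall>h.
        t + oriented_integral x (x + h) (\<lambda>\<xi>. 1 / lam j \<xi>) \<in> {0..T} \<and> x + h \<in> {0..1} \<longrightarrow>
        z (t + oriented_integral x (x + h) (\<lambda>\<xi>. 1 / lam j \<xi>)) (x + h) $ j =
          exp (- oriented_integral x (x + h) (\<lambda>\<xi>. d j \<xi> / lam j \<xi>)) * z t x $ j)"

text \<open>The condition \<open>z T \<in> Lq q 0 1\<close> holds for every solution with \<open>L\<^sup>q\<close> data. It is stated because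
  the integral in \<open>Lq_norm\<close> is 0 if the integrand is not integrable.\<close>

definition approx_controllable ::
  "('k::finite, 'n::finite) pre_digraph \<Rightarrow> real^'n^'k \<Rightarrow> real^'m::finite^'k \<Rightarrow>
   ('n \<Rightarrow> real \<Rightarrow> real) \<Rightarrow> ('n \<Rightarrow> real \<Rightarrow> real) \<Rightarrow> real \<Rightarrow> real \<Rightarrow> bool" where
  "approx_controllable G w \<Gamma> lam d q T \<longleftrightarrow>
     (\<forall>\<epsilon>>0. \<forall>\<phi>\<in>Lq q 0 1. \<forall>\<psi>\<in>Lq q 0 1. \<exists>u\<in>Lq q 0 T. \<exists>z.
        network_solution G w \<Gamma> lam d T \<phi> u z \<and> z T \<in> Lq q 0 1 \<and>
        Lq_norm q 0 1 (\<lambda>x. z T x - \<psi> x) < \<epsilon>)"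

end

(* Suppose that two edges i and j leave the same vertex. By the boundary condition, up to nonzero
   weights they receive the same signal g at x = 1, and transport along the characteristics carries
   this signal, up to the positive factors exp(- integral of d/lam), to z(T,.) near x = 1. So the final profiles
   on i and j determine each other near x = 1, which prevents them from approximating 1 on edge i
   and 0 on edge j. The two profiles are compared at points x and y with the same travel time s to
   the vertex; s must avoid the images of null sets under the travel times, which are null since the
   travel times are Lipschitz.
   Hence tail is injective. As every vertex has outgoing and incoming edges, counting makes tail and
   head bijections from edges to vertices, and the cycles of G are the orbits of the permutation
   that sends each edge to its successor. *)

theory Submission
  imports Defs "HOL-Combinatorics.Orbits"
begin

subsection \<open>Digraphs with unique outgoing and incoming arcs\<close>

text \<open>As \<open>f e\<close> starts where \<open>e\<close> ends, iterating \<open>f\<close>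
  traces a walk. Its end is written as the tail of the next arc, which covers the empty walk and
  closes the walk when \<open>(f ^^ n) s = s\<close>.\<close>

lemma cas_funpow:
  assumes "f permutes arcs G" and "\<And>e. e \<in> arcs G \<Longrightarrow> tail G (f e) = head G e" and "s \<in> arcs G"
  shows "pre_digraph.cas G (tail G s) (map (\<lambda>i. (f ^^ i) s) [0..<n]) (tail G ((f ^^ n) s))"
  using assms(3)
proof (induction n arbitrary: s)
  case 0
  then show ?case by (simp add: pre_digraph.cas.simps)
next
  case (Suc n)
  have "f s \<in> arcs G"
    using Suc.prems assms(1) by (simp add: permutes_in_image)
  \<comment> \<open>The first arc is split off, since \<open>cas\<close> recurses from the front;
    the induction hypothesis is then used at \<open>f s\<close>.\<close>
  moreover have "map (\<lambda>i. (f ^^ i) s) [0..<Suc n] = s # map (\<lambda>i. (f ^^ i) (f s)) [0..<n]"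
    by (simp add: upt_conv_Cons map_Suc_upt[symmetric] funpow_swap1 o_def del: upt_Suc)
  ultimately show ?case
    using Suc.IH[of "f s"] Suc.prems assms(2) by (simp add: pre_digraph.cas.simps funpow_swap1 del: upt_Suc)
qed

text \<open>Listing the orbit of \<open>s\<close> over one period gives a closed walk that uses each
  arc once; injectivity of \<open>head\<close> keeps it from meeting a vertex twice.\<close>

lemma directed_cycle_graph_orbit:
  fixes G :: "('a, 'b) pre_digraph"
  assumes fin: "finite (arcs G)" and f: "f permutes arcs G" "\<And>e. e \<in> arcs G \<Longrightarrow> tail G (f e) = head G e"
    and inj: "inj_on (head G) (arcs G)"
    and s: "s \<in> arcs G"
    and C: "C = \<lparr>verts = tail G ` orbit f s, arcs = orbit f s, tail = tail G, head = head G\<rparr>"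
  shows "directed_cycle_graph C"
proof -
  have "permutation f"
    using f(1) fin by (auto simp: permutation_permutes)
  then have self: "s \<in> orbit f s"
    by (rule permutation_self_in_orbit)
  \<comment> \<open>The period of \<open>s\<close>: the least positive number of iterations leading
    back to \<open>s\<close>. It is 1 for a loop, so the walk below is never empty.\<close>
  define n where "n = funpow_dist1 f s s"
  have n: "(f ^^ n) s = s" "0 < n"
    using funpow_dist1_prop[OF self] by (auto simp: n_def)
  define p where "p = map (\<lambda>i. (f ^^ i) s) [0..<n]"
  have set_p: "set p = orbit f s"
    using orbit_conv_funpow_dist1[OF self] by (simp only: p_def n_def set_map set_upt)
  have "p \<noteq> []"
    using n(2) by (simp add: p_def)
  have "distinct p"
    using inj_on_funpow_dist1[OF self] by (simp only: p_def n_def distinct_map distinct_upt set_upt simp_thms)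
  moreover have "set p \<subseteq> arcs G"
    using permutes_orbit_subset[OF f(1) s] set_p by simp
  ultimately have "distinct (map (head G) p)"
    using inj by (auto simp: distinct_map intro: inj_on_subset)
  have cas_eq: "pre_digraph.cas C u q v = pre_digraph.cas G u q v" for u q v
    by (induction q arbitrary: u) (auto simp: pre_digraph.cas.simps C)
  have cas: "pre_digraph.cas C (tail G s) p (tail G s)"
    using cas_funpow[OF f s, of n] n(1) by (simp add: cas_eq p_def)
  have "pre_digraph.awalk C (tail G s) p (tail G s)"
    using cas self set_p by (simp add: pre_digraph.awalk_def C)
  \<comment> \<open>The vertices of the walk are its start followed by the heads of its arcs.
    \<open>tl\<close> drops the start, which the closed walk repeats at its end.\<close>
  moreover have "distinct (tl (pre_digraph.awalk_verts C (tail G s) p))"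
    using \<open>distinct (map (head G) p)\<close> \<open>p \<noteq> []\<close> pre_digraph.awalk_verts_conv'[OF cas]
    by (simp add: C)
  ultimately have "pre_digraph.cycle C p"
    using \<open>p \<noteq> []\<close> by (auto simp: pre_digraph.cycle_def)
  then show ?thesis
    using set_p by (auto simp: directed_cycle_graph_def C)
qed

lemma disjoint_union_of_directed_cycles:
  assumes fin: "finite (arcs G)"
    and tail: "bij_betw (tail G) (arcs G) (verts G)" and head: "bij_betw (head G) (arcs G) (verts G)"
  shows "\<exists>\<C>. finite \<C> \<and> (\<forall>C\<in>\<C>. directed_cycle_graph C) \<and> disjoint_union_of G \<C>"
proof -
  \<comment> \<open>The successor of an arc is the unique arc leaving its head. Outside
    \<open>arcs G\<close> the map is the identity, as \<open>permutes\<close> demands.\<close>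
  define f where "f e = (if e \<in> arcs G then inv_into (arcs G) (tail G) (head G e) else e)" for e
  have "bij_betw (inv_into (arcs G) (tail G) \<circ> head G) (arcs G) (arcs G)"
    using head bij_betw_inv_into[OF tail] by (rule bij_betw_trans)
  then have "bij_betw f (arcs G) (arcs G)"
    by (subst bij_betw_cong[where g = "inv_into (arcs G) (tail G) \<circ> head G"]) (auto simp: f_def)
  then have f: "f permutes arcs G"
    by (rule bij_imp_permutes) (simp add: f_def)
  have tail_f: "tail G (f e) = head G e" if "e \<in> arcs G" for e
    using that head tail by (auto simp: f_def bij_betw_def intro!: f_inv_into_f)
  have perm: "permutation f"
    using f fin by (auto simp: permutation_permutes)
  have wf: "wf_digraph G"
    using tail head by (auto simp: wf_digraph_def bij_betw_def)
  define C where
    "C s = \<lparr>verts = tail G ` orbit f s, arcs = orbit f s, tail = tail G, head = head G\<rparr>" for s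
  have sub: "orbit f s \<subseteq> arcs G" if "s \<in> arcs G" for s
    using permutes_orbit_subset[OF f that] .
  have "subgraph (C s) G" if s: "s \<in> arcs G" for s
  proof -
    \<comment> \<open>Only tails were taken as vertices of \<open>C s\<close>; they include the
      heads because the orbit is closed under \<open>f\<close>.\<close>
    have "head G e \<in> tail G ` orbit f s" if "e \<in> orbit f s" for e
    proof -
      have "f e \<in> orbit f s" using that by (rule orbit.step)
      moreover have "tail G (f e) = head G e" using that s sub tail_f by blast
      ultimately show ?thesis by force
    qed
    then have "wf_digraph (C s)"
      by (auto simp: wf_digraph_def C_def)
    then show ?thesis
      using wf sub[OF s] tail by (auto simp: subgraph_def compatible_def C_def bij_betw_def)
  qed
  \<comment> \<open>Different arcs of one orbit give the same component, so the assumption is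
    \<open>C s \<noteq> C t\<close>. Disjointness of the orbits passes to the vertices by
    injectivity of \<open>tail\<close>.\<close>
  moreover have "verts (C s) \<inter> verts (C t) = {} \<and> arcs (C s) \<inter> arcs (C t) = {}"
    if s: "s \<in> arcs G" and t: "t \<in> arcs G" and ne: "C s \<noteq> C t" for s t
  proof -
    have "orbit f s \<inter> orbit f t = {}"
    proof (rule ccontr)
      assume "orbit f s \<inter> orbit f t \<noteq> {}"
      then obtain e where "e \<in> orbit f s" "e \<in> orbit f t" by blast
      then have "orbit f e = orbit f s" "orbit f e = orbit f t"
        using orbit_cyclic_eq3[OF cyclic_on_orbit'[OF perm]] by blast+
      then show False using ne by (simp add: C_def)
    qed
    moreover have "inj_on (tail G) (orbit f s \<union> orbit f t)"
      using tail sub s t by (auto simp: bij_betw_def intro: inj_on_subset)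
    ultimately show ?thesis
      by (auto simp: C_def inj_on_def)
  qed
  moreover have "G = pre_digraph.Union G (C ` arcs G)"
  proof (rule pre_digraph.equality)
    have arcs: "arcs G = (\<Union>s\<in>arcs G. orbit f s)"
      using sub permutation_self_in_orbit[OF perm] by blast
    then show "arcs G = arcs (pre_digraph.Union G (C ` arcs G))"
      by (simp add: pre_digraph.Union_def C_def)
    show "verts G = verts (pre_digraph.Union G (C ` arcs G))"
      using tail arcs by (simp add: pre_digraph.Union_def C_def bij_betw_def image_UN[symmetric])
  qed (simp_all add: pre_digraph.Union_def)
  ultimately have "disjoint_union_of G (C ` arcs G)"
    by (auto simp: disjoint_union_of_def pairwise_def)
  moreover have "directed_cycle_graph (C s)" if "s \<in> arcs G" for s
    using directed_cycle_graph_orbit[OF fin f tail_f _ that C_def] head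
    by (simp add: bij_betw_def)
  ultimately show ?thesis
    using fin by (intro exI[of _ "C ` arcs G"]) auto
qed

text \<open>Both maps are onto the vertices. Injectivity of \<open>tail\<close> gives as many arcs
  as vertices, and a surjection between finite sets of equal size is injective.\<close>

lemma bij_tail_head:
  assumes fin: "finite (arcs G)" and wf: "wf_digraph G"
    and out: "\<And>v. v \<in> verts G \<Longrightarrow> out_arcs G v \<noteq> {}" and inc: "\<And>v. v \<in> verts G \<Longrightarrow> in_arcs G v \<noteq> {}"
    and inj: "inj_on (tail G) (arcs G)"
  shows "bij_betw (tail G) (arcs G) (verts G)" "bij_betw (head G) (arcs G) (verts G)"
proof -
  have img: "tail G ` arcs G = verts G" "head G ` arcs G = verts G"
  proof -
    show "tail G ` arcs G = verts G"
    proof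
      show "verts G \<subseteq> tail G ` arcs G"
      proof
        fix v assume "v \<in> verts G"
        then obtain e where "e \<in> out_arcs G v" using out by blast
        then show "v \<in> tail G ` arcs G" by auto
      qed
    qed (use wf in \<open>auto simp: wf_digraph_def\<close>)
    show "head G ` arcs G = verts G"
    proof
      show "verts G \<subseteq> head G ` arcs G"
      proof
        fix v assume "v \<in> verts G"
        then obtain e where "e \<in> in_arcs G v" using inc by blast
        then show "v \<in> head G ` arcs G" by auto
      qed
    qed (use wf in \<open>auto simp: wf_digraph_def\<close>)
  qed
  then have "card (head G ` arcs G) = card (arcs G)"
    using inj by (metis card_image)
  then have "inj_on (head G) (arcs G)"
    using fin by (rule eq_card_imp_inj_on[rotated])
  then show "bij_betw (tail G) (arcs G) (verts G)" "bij_betw (head G) (arcs G) (verts G)"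
    using inj img by (auto simp: bij_betw_def)
qed

subsection \<open>Controllability and common tails\<close>

lemma negligible_Collect_not_AE:
  fixes a b :: real
  assumes "AE x in lebesgue_on {a..b}. P x"
  shows "negligible {x \<in> {a..b}. \<not> P x}"
proof -
  have "AE x in lebesgue. x \<in> {a..b} \<longrightarrow> P x"
    using assms by (subst (asm) AE_restrict_space_iff) auto
  then have "{x \<in> space lebesgue. \<not> (x \<in> {a..b} \<longrightarrow> P x)} \<in> null_sets lebesgue"
    by (simp add: completion.AE_iff_null_sets)
  then show ?thesis
    by (simp add: negligible_iff_null_sets)
qed

lemma Linf_imp_integrable:
  assumes "p \<in> Linf a b"
  shows "integrable (lebesgue_on {a..b}) p"
proof -
  obtain B where "AE x in lebesgue_on {a..b}. \<bar>p x\<bar> \<le> B" "p \<in> borel_measurable (lebesgue_on {a..b})"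
    using assms by (auto simp: Linf_def)
  moreover have "finite_measure (lebesgue_on {a..b})"
    by (rule finite_measure_lebesgue_on) simp
  ultimately show ?thesis
    by (intro finite_measure.integrable_const_bound[of _ _ B]) auto
qed

text \<open>The increment is the integral between \<open>x\<close> and \<open>y\<close>, where
  \<open>p\<close> is essentially bounded. The upper limit \<open>b\<close> is fixed because travel
  times are measured to the end \<open>x = 1\<close> of an edge.\<close>

lemma Linf_integral_Lipschitz:
  assumes "p \<in> Linf a b"
  obtains B where "\<And>x y. x \<in> {a..b} \<Longrightarrow> y \<in> {a..b} \<Longrightarrow>
    \<bar>integral {y..b} p - integral {x..b} p\<bar> \<le> B * \<bar>y - x\<bar>"
proof -
  obtain B where "AE x in lebesgue_on {a..b}. \<bar>p x\<bar> \<le> B"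
    using assms by (auto simp: Linf_def)
  then have "negligible {x \<in> {a..b}. \<not> \<bar>p x\<bar> \<le> B}" (is "negligible ?N")
    by (rule negligible_Collect_not_AE)
  have p: "p integrable_on {a..b}"
    using Linf_imp_integrable[OF assms] by (rule integrable_on_lebesgue_on) simp
  \<comment> \<open>Changing \<open>p\<close> on the exceptional null set keeps its integrals and
    makes the bound hold at every point. The bound is \<open>\<bar>B\<bar>\<close> so that it also
    covers the value 0 if \<open>B\<close> is negative.\<close>
  define p' where "p' x = (if x \<in> ?N then 0 else p x)" for x
  have p'_bound: "\<bar>p' x\<bar> \<le> \<bar>B\<bar>" if "x \<in> {a..b}" for x
    using that by (auto simp: p'_def)
  have p': "p' integrable_on {a..b}"
    using p \<open>negligible ?N\<close> by (rule integrable_spike) (simp add: p'_def)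
  have *: "\<bar>integral {x..b} p - integral {y..b} p\<bar> \<le> \<bar>B\<bar> * (y - x)"
    if "a \<le> x" "x \<le> y" "y \<le> b" for x y
  proof -
    have "p integrable_on {x..b}"
      using p that by (auto intro: integrable_on_subinterval)
    then have "integral {x..b} p - integral {y..b} p = integral {x..y} p"
      using Henstock_Kurzweil_Integration.integral_combine[of x y b p] that by simp
    also have "\<dots> = integral {x..y} p'"
      using \<open>negligible ?N\<close> by (rule integral_spike) (use that in \<open>auto simp: p'_def\<close>)
    finally have eq: "integral {x..b} p - integral {y..b} p = integral {x..y} p'" .
    have "norm (integral {x..y} p') \<le> integral {x..y} (\<lambda>_. \<bar>B\<bar>)"
      using that p'_bound p'
      by (intro Henstock_Kurzweil_Integration.integral_norm_bound_integral)
         (auto intro: integrable_on_subinterval)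
    then show ?thesis
      using eq that by (simp add: mult.commute)
  qed
  have "\<bar>integral {y..b} p - integral {x..b} p\<bar> \<le> \<bar>B\<bar> * \<bar>y - x\<bar>"
    if "x \<in> {a..b}" "y \<in> {a..b}" for x y
    using *[of x y] *[of y x] that by (cases "x \<le> y") (auto simp: abs_minus_commute)
  then show thesis by (rule that)
qed

text \<open>Positivity is only pointwise, without a positive lower bound: a vanishing integral would
  make \<open>p\<close> vanish almost everywhere, so the whole interval would be null.\<close>

lemma integral_pos:
  fixes p :: "real \<Rightarrow> real"
  assumes p: "integrable (lebesgue_on {a..b}) p" and pos: "\<And>x. x \<in> {a..b} \<Longrightarrow> 0 < p x" and "a < b"
  shows "0 < integral {a..b} p"
proof -
  have eq: "integral\<^sup>L (lebesgue_on {a..b}) p = integral {a..b} p"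
    using p by (rule lebesgue_integral_eq_integral) simp
  have nonneg: "AE x in lebesgue_on {a..b}. 0 \<le> p x"
    using pos by (auto intro!: AE_I2 less_imp_le)
  have "integral\<^sup>L (lebesgue_on {a..b}) p \<noteq> 0"
  proof
    assume "integral\<^sup>L (lebesgue_on {a..b}) p = 0"
    then have "AE x in lebesgue_on {a..b}. p x = 0"
      using integral_nonneg_eq_0_iff_AE[OF p nonneg] by simp
    then have "negligible {x \<in> {a..b}. p x \<noteq> 0}"
      by (rule negligible_Collect_not_AE)
    moreover have "{x \<in> {a..b}. p x \<noteq> 0} = cbox a b"
      using pos by force
    ultimately show False
      using \<open>a < b\<close> by (metis negligible_interval(1) box_real(1) greaterThanLessThan_empty_iff not_le)
  qed
  moreover have "0 \<le> integral\<^sup>L (lebesgue_on {a..b}) p"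
    using nonneg by (rule integral_nonneg_AE)
  ultimately show ?thesis
    using eq by simp
qed

section \<open>L^q functions and convergence almost everywhere\<close>

lemma Lq_const: "(\<lambda>_. c) \<in> Lq q a b"
  by (auto simp: Lq_def intro!: finite_measure.integrable_const finite_measure_lebesgue_on)

lemma Lq_diff:
  assumes f: "f \<in> Lq q a b" and g: "g \<in> Lq q a b" and q: "0 \<le> q"
  shows "(\<lambda>x. f x - g x) \<in> Lq q a b"
proof -
  have [measurable]: "f \<in> borel_measurable (lebesgue_on {a..b})" "g \<in> borel_measurable (lebesgue_on {a..b})"
    using f g by (auto simp: Lq_def)
  \<comment> \<open>Comparing with twice the larger of the two norms needs only monotonicity of the
    power, hence works for every \<open>q \<ge> 0\<close>.\<close>
  have bound: "norm (f x - g x) powr q \<le> 2 powr q * (norm (f x) powr q + norm (g x) powr q)" for x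
  proof -
    have "norm (f x - g x) \<le> 2 * max (norm (f x)) (norm (g x))"
      using norm_triangle_ineq4[of "f x" "g x"] by linarith
    then have "norm (f x - g x) powr q \<le> (2 * max (norm (f x)) (norm (g x))) powr q"
      using q by (intro powr_mono2) auto
    also have "\<dots> = 2 powr q * max (norm (f x)) (norm (g x)) powr q"
      by (simp add: powr_mult)
    also have "\<dots> \<le> 2 powr q * (norm (f x) powr q + norm (g x) powr q)"
      by (intro mult_left_mono) (auto simp: max_def)
    finally show ?thesis .
  qed
  have "integrable (lebesgue_on {a..b}) (\<lambda>x. 2 powr q * (norm (f x) powr q + norm (g x) powr q))"
    using f g by (auto simp: Lq_def)
  then have "integrable (lebesgue_on {a..b}) (\<lambda>x. norm (f x - g x) powr q)"
    by (rule Bochner_Integration.integrable_bound) (use bound in \<open>auto simp del: distrib_left_numeral\<close>)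
  then show ?thesis
    by (simp add: Lq_def)
qed

text \<open>Convergence to 0 in L^q is convergence to 0 in L^1 of the q-th powers of the norms, for
  which an almost everywhere convergent subsequence exists; taking q-th roots returns to
  \<open>f\<close>.\<close>

lemma Lq_norm_tendsto_0_AE_subseq:
  assumes q: "0 < q" and f: "\<And>n. f n \<in> Lq q a b" and lim: "(\<lambda>n. Lq_norm q a b (f n)) \<longlonglongrightarrow> 0"
  obtains r :: "nat \<Rightarrow> nat" where "AE x in lebesgue_on {a..b}. (\<lambda>n. f (r n) x) \<longlonglongrightarrow> 0"
proof -
  define I where "I n = (LINT x|lebesgue_on {a..b}. norm (f n x) powr q)" for n
  have "0 \<le> I n" for n
    by (simp add: I_def)
  then have "Lq_norm q a b (f n) powr q = I n" for n
    using q by (simp add: Lq_norm_def I_def[symmetric] powr_powr)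
  moreover have "(\<lambda>n. Lq_norm q a b (f n) powr q) \<longlonglongrightarrow> 0"
    using q by (intro tendsto_zero_powrI[OF lim tendsto_const]) (auto simp: Lq_norm_def)
  ultimately have "(\<lambda>n. LINT x|lebesgue_on {a..b}. norm (norm (f n x) powr q)) \<longlonglongrightarrow> 0"
    by (simp add: I_def)
  moreover have "integrable (lebesgue_on {a..b}) (\<lambda>x. norm (f n x) powr q)" for n
    using f by (simp add: Lq_def)
  ultimately obtain r :: "nat \<Rightarrow> nat"
    where r: "AE x in lebesgue_on {a..b}. (\<lambda>n. norm (f (r n) x) powr q) \<longlonglongrightarrow> 0"
    using tendsto_L1_AE_subseq[of "lebesgue_on {a..b}" "\<lambda>n x. norm (f n x) powr q"] by blast
  have "(\<lambda>n. f (r n) x) \<longlonglongrightarrow> 0" if "(\<lambda>n. norm (f (r n) x) powr q) \<longlonglongrightarrow> 0" for x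
  proof -
    have "(\<lambda>n. (norm (f (r n) x) powr q) powr (1 / q)) \<longlonglongrightarrow> 0"
      using q by (intro tendsto_zero_powrI[OF that tendsto_const]) auto
    then show ?thesis
      using q by (simp add: powr_powr tendsto_norm_zero_iff)
  qed
  then show thesis
    using that r by (metis (mono_tags, lifting) eventually_mono)
qed

section \<open>Lipschitz images and transport along characteristics\<close>

lemma negligible_Lipschitz_image:
  fixes f :: "real \<Rightarrow> real"
  assumes "negligible N" and "\<And>x y. x \<in> N \<Longrightarrow> y \<in> N \<Longrightarrow> \<bar>f y - f x\<bar> \<le> B * \<bar>y - x\<bar>"
  shows "negligible (f ` N)"
  using assms by (intro negligible_locally_Lipschitz_image) (auto intro!: exI[of _ UNIV] exI[of _ B])


text \<open>For \<open>x \<le> 1\<close> the oriented integral is taken over the open interval with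
  positive sign, and endpoints do not affect the value. This makes the results on
  \<open>integral\<close> available for travel times.\<close>

lemma oriented_integral_eq_integral:
  assumes "integrable (lebesgue_on {0..1}) f" and "x \<in> {0..1}"
  shows "oriented_integral x 1 f = integral {x..1} f"
proof -
  have "set_integrable lebesgue {0..1} f"
    using assms(1) by (simp add: set_integrable_def integrable_restrict_space)
  then have "set_integrable lebesgue {x<..<1} f"
    by (rule set_integrable_subset) (use assms(2) in auto)
  then have "oriented_integral x 1 f = integral {x<..<1} f"
    using assms(2) by (simp add: interval_lebesgue_integral_def set_lebesgue_integral_eq_integral)
  then show ?thesis
    by (simp add: integral_open_interval_real)
qed

text \<open>The characteristic through \<open>(T, x)\<close> is followed back to the end 1 of the
  edge, with step \<open>h = 1 - x\<close>; it gets there at time \<open>T - s\<close>. The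
  exponential factor keeps its form, as later only its positivity and its independence of the
  solution matter.\<close>

lemma network_solution_along_characteristic:
  assumes sol: "network_solution G w \<Gamma> lam d T \<phi> u z"
    and lam: "integrable (lebesgue_on {0..1}) (\<lambda>\<xi>. 1 / lam j \<xi>)"
    and x: "x \<in> {0..1}" and s: "s = - integral {x..1} (\<lambda>\<xi>. 1 / lam j \<xi>)" "0 \<le> s" "s \<le> T"
  shows "z (T - s) 1 $ j = exp (- oriented_integral x 1 (\<lambda>\<xi>. d j \<xi> / lam j \<xi>)) * z T x $ j"
proof -
  have "\<forall>t\<in>{0..T}. \<forall>x\<in>{0..1}. \<forall>h.
      t + oriented_integral x (x + h) (\<lambda>\<xi>. 1 / lam j \<xi>) \<in> {0..T} \<and> x + h \<in> {0..1} \<longrightarrow>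
      z (t + oriented_integral x (x + h) (\<lambda>\<xi>. 1 / lam j \<xi>)) (x + h) $ j =
        exp (- oriented_integral x (x + h) (\<lambda>\<xi>. d j \<xi> / lam j \<xi>)) * z t x $ j"
    using sol unfolding network_solution_def by blast
  from this[rule_format, of T x "1 - x"] show ?thesis
    using oriented_integral_eq_integral[OF lam x] x s by simp
qed

text \<open>Steering from 0 to the constant profile \<open>c\<close> with errors
  \<open>1 / (n + 1)\<close> gives convergence in L^q; a subsequence converges almost everywhere,
  which allows evaluation at single points.\<close>

lemma approx_controllable_imp_convergent_solutions:
  assumes contr: "approx_controllable G w \<Gamma> lam d q T" and q: "0 < q"
  obtains u :: "nat \<Rightarrow> real \<Rightarrow> real^'m::finite" and z :: "nat \<Rightarrow> real \<Rightarrow> real \<Rightarrow> real^'n::finite"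
  where "\<And>n. network_solution (G :: ('k::finite, 'n) pre_digraph) w \<Gamma> lam d T (\<lambda>_. 0) (u n) (z n)"
    and "AE x in lebesgue_on {0..1}. (\<lambda>n. z n T x) \<longlonglongrightarrow> c"
proof -
  have "\<exists>u z. network_solution G w \<Gamma> lam d T (\<lambda>_. 0) u z \<and> z T \<in> Lq q 0 1 \<and>
      Lq_norm q 0 1 (\<lambda>x. z T x - c) < inverse (real (Suc n))" for n
    using contr[unfolded approx_controllable_def, rule_format, of "inverse (real (Suc n))" "\<lambda>_. 0" "\<lambda>_. c"]
      Lq_const by (metis inverse_positive_iff_positive of_nat_0_less_iff zero_less_Suc)
  then obtain u z where sol: "\<And>n. network_solution G w \<Gamma> lam d T (\<lambda>_. 0) (u n) (z n)"
    and zT: "\<And>n. z n T \<in> Lq q 0 1"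
    and norm: "\<And>n. Lq_norm q 0 1 (\<lambda>x. z n T x - c) < inverse (real (Suc n))"
    by metis
  have "(\<lambda>n. Lq_norm q 0 1 (\<lambda>x. z n T x - c)) \<longlonglongrightarrow> 0"
  proof (rule tendsto_sandwich[OF _ _ tendsto_const LIMSEQ_inverse_real_of_nat])
    show "\<forall>\<^sub>F n in sequentially. 0 \<le> Lq_norm q 0 1 (\<lambda>x. z n T x - c)"
      by (simp add: Lq_norm_def)
    show "\<forall>\<^sub>F n in sequentially. Lq_norm q 0 1 (\<lambda>x. z n T x - c) \<le> inverse (real (Suc n))"
      using norm by (auto intro!: always_eventually less_imp_le)
  qed
  moreover have "(\<lambda>x. z n T x - c) \<in> Lq q 0 1" for n
    using zT Lq_const q by (intro Lq_diff) auto
  ultimately obtain r :: "nat \<Rightarrow> nat"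
    where "AE x in lebesgue_on {0..1}. (\<lambda>n. z (r n) T x - c) \<longlonglongrightarrow> 0"
    using Lq_norm_tendsto_0_AE_subseq[OF q, of "\<lambda>n x. z n T x - c"] by blast
  then have "AE x in lebesgue_on {0..1}. (\<lambda>n. z (r n) T x) \<longlonglongrightarrow> c"
    by (simp add: LIM_zero_iff)
  then show thesis
    using sol by (intro that[of "u \<circ> r" "z \<circ> r"]) auto
qed

lemma inj_tail_if_approx_controllable:
  fixes G :: "('k::finite, 'n::finite) pre_digraph" and \<Gamma> :: "real^'m::finite^'k"
  assumes w: "\<And>i j. w $ i $ j = 0 \<longleftrightarrow> outgoing_incidence G $ i $ j = 0"
    and neg: "\<And>j x. x \<in> {0..1} \<Longrightarrow> lam j x < 0"
    and Linf: "\<And>j. (\<lambda>x. 1 / lam j x) \<in> Linf 0 1"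
    and q: "0 < q" and T: "0 < T"
    and contr: "approx_controllable G w \<Gamma> lam d q T"
  shows "inj (tail G)"
proof (rule injI, rule ccontr)
  fix i j assume tail: "tail G i = tail G j" and "i \<noteq> j"
  obtain u :: "nat \<Rightarrow> real \<Rightarrow> real^'m" and z
    where sol: "\<And>n. network_solution G w \<Gamma> lam d T (\<lambda>_. 0) (u n) (z n)"
      and conv: "AE x in lebesgue_on {0..1}. (\<lambda>n. z n T x) \<longlonglongrightarrow> axis i 1"
    using approx_controllable_imp_convergent_solutions[OF contr q] by metis
  \<comment> \<open>The signal at the common vertex, inflow plus control. The vertex
    \<open>tail G i\<close> serves both edges.\<close>
  define g where "g n t =
    (\<Sum>e\<in>UNIV. incoming_incidence G $ tail G i $ e * z n t 0 $ e) + (\<Sum>l\<in>UNIV. \<Gamma> $ tail G i $ l * u n t $ l)"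
    for n t
  define W where "W k = w $ tail G k $ k" for k
  have W: "W k \<noteq> 0" for k
    by (simp add: W_def w outgoing_incidence_def)
  \<comment> \<open>The exceptional times depend on the solution. A sequence of solutions keeps
    their union null.\<close>
  define M where "M n = {t \<in> {0..T}. \<not> (z n t 1 $ i = W i * g n t \<and> z n t 1 $ j = W j * g n t)}" for n
  have "negligible (M n)" for n
    unfolding M_def
  proof (rule negligible_Collect_not_AE)
    have "AE t in lebesgue_on {0..T}. \<forall>v e.
        outgoing_incidence G $ v $ e * z n t 1 $ e =
          w $ v $ e * (\<Sum>e\<in>UNIV. incoming_incidence G $ v $ e * z n t 0 $ e)
          + w $ v $ e * (\<Sum>l\<in>UNIV. \<Gamma> $ v $ l * u n t $ l)"
      using sol[of n] by (simp add: network_solution_def)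
    then show "AE t in lebesgue_on {0..T}. z n t 1 $ i = W i * g n t \<and> z n t 1 $ j = W j * g n t"
    proof (rule eventually_mono, goal_cases)
      case (1 t)
      from this[rule_format, of "tail G i" i] this[rule_format, of "tail G j" j]
      show ?case
        by (simp add: outgoing_incidence_def g_def W_def tail distrib_left)
    qed
  qed
  then have M: "negligible (\<Union>n. M n)"
    by (intro negligible_countable_Union) auto
  define N where "N = {x \<in> {0..1}. \<not> (\<lambda>n. z n T x) \<longlonglongrightarrow> axis i 1}"
  have N: "negligible N"
    unfolding N_def using conv by (rule negligible_Collect_not_AE)
  \<comment> \<open>As \<open>lam\<close> is negative, signals enter edge \<open>k\<close> at 1 and
    move towards 0; \<open>\<tau> k x\<close> is the time they take to reach
    \<open>x\<close>.\<close>
  define \<tau> where "\<tau> k x = - integral {x..1} (\<lambda>\<xi>. 1 / lam k \<xi>)" for k x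
  have int: "integrable (lebesgue_on {0..1}) (\<lambda>\<xi>. 1 / lam k \<xi>)" for k
    using Linf by (rule Linf_imp_integrable)
  have \<tau>_cont: "continuous_on {0..1} (\<tau> k)" for k
    unfolding \<tau>_def using int
    by (intro continuous_intros indefinite_integral_continuous_1' integrable_on_lebesgue_on) auto
  have \<tau>_pos: "0 < \<tau> k 0" for k
    using integral_pos[of 0 1 "\<lambda>\<xi>. - (1 / lam k \<xi>)"] int neg by (simp add: \<tau>_def)
  have \<tau>_N: "negligible (\<tau> k ` N)" for k
  proof -
    obtain B where B: "\<And>x y. x \<in> {0..1} \<Longrightarrow> y \<in> {0..1} \<Longrightarrow>
      \<bar>integral {y..1} (\<lambda>\<xi>. 1 / lam k \<xi>) - integral {x..1} (\<lambda>\<xi>. 1 / lam k \<xi>)\<bar> \<le> B * \<bar>y - x\<bar>"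
      using Linf_integral_Lipschitz[OF Linf] by metis
    have "\<bar>\<tau> k y - \<tau> k x\<bar> \<le> B * \<bar>y - x\<bar>" if "x \<in> N" "y \<in> N" for x y
      using B[of x y] that by (simp add: \<tau>_def N_def abs_minus_commute)
    with N show ?thesis
      by (rule negligible_Lipschitz_image)
  qed
  have TM: "negligible ((\<lambda>t. T - t) ` (\<Union>n. M n))"
    using M by (rule negligible_Lipschitz_image[where B = 1]) auto
  \<comment> \<open>Below \<open>T\<close>, the emission time \<open>T - s\<close> lies in the time
    interval; below \<open>\<tau> i 0\<close> and \<open>\<tau> j 0\<close>, \<open>s\<close> is
    attained as a travel time on both edges.\<close>
  define \<delta> where "\<delta> = min T (min (\<tau> i 0) (\<tau> j 0))"
  have "0 < \<delta>"
    using T \<tau>_pos by (simp add: \<delta>_def)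
  \<comment> \<open>Avoiding this set makes the profiles converge at every point of edges
    \<open>i\<close> and \<open>j\<close> with travel time \<open>s\<close>, and the boundary
    condition hold at time \<open>T - s\<close> for all \<open>n\<close>.\<close>
  have "negligible (\<tau> i ` N \<union> \<tau> j ` N \<union> (\<lambda>t. T - t) ` (\<Union>n. M n))"
    using \<tau>_N TM by (intro negligible_Un)
  moreover have "\<not> negligible {0<..<\<delta>}"
    using \<open>0 < \<delta>\<close> by (intro open_not_negligible) auto
  ultimately have "\<not> {0<..<\<delta>} \<subseteq> \<tau> i ` N \<union> \<tau> j ` N \<union> (\<lambda>t. T - t) ` (\<Union>n. M n)"
    using negligible_subset by blast
  then obtain s where "s \<in> {0<..<\<delta>}" "s \<notin> \<tau> i ` N \<union> \<tau> j ` N \<union> (\<lambda>t. T - t) ` (\<Union>n. M n)"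
    unfolding subset_iff by metis
  then have s: "0 < s" "s < \<delta>" "s \<notin> \<tau> i ` N" "s \<notin> \<tau> j ` N" "s \<notin> (\<lambda>t. T - t) ` (\<Union>n. M n)"
    by simp_all
  have "T - s \<notin> M n" for n
  proof
    assume "T - s \<in> M n"
    then have "T - (T - s) \<in> (\<lambda>t. T - t) ` (\<Union>n. M n)" by blast
    with s(5) show False by simp
  qed
  then have bc: "z n (T - s) 1 $ i = W i * g n (T - s)" "z n (T - s) 1 $ j = W j * g n (T - s)" for n
    using s(1,2) by (auto simp: M_def \<delta>_def)
  have lim: "\<exists>E>0. (\<lambda>n. z n (T - s) 1 $ k) \<longlonglongrightarrow> E * axis i 1 $ k" if "s < \<tau> k 0" "s \<notin> \<tau> k ` N" for k
  proof -
    \<comment> \<open>Intermediate values between \<open>\<tau> k 1 = 0\<close> and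
      \<open>\<tau> k 0 > s\<close>.\<close>
    have "\<exists>x\<ge>0. x \<le> 1 \<and> \<tau> k x = s"
      using that s(1) \<tau>_cont[of k] by (intro IVT2') (auto simp: \<tau>_def)
    then obtain x where x: "x \<in> {0..1}" "\<tau> k x = s"
      by auto
    then have "(\<lambda>n. z n T x) \<longlonglongrightarrow> axis i 1"
      using that(2) by (auto simp: N_def)
    moreover have "z n (T - s) 1 $ k = exp (- oriented_integral x 1 (\<lambda>\<xi>. d k \<xi> / lam k \<xi>)) * z n T x $ k" for n
      using x s(1,2)
      by (intro network_solution_along_characteristic[OF sol int]) (auto simp: \<tau>_def \<delta>_def)
    ultimately show ?thesis
      by (intro exI[of _ "exp (- oriented_integral x 1 (\<lambda>\<xi>. d k \<xi> / lam k \<xi>))"])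
         (auto intro!: tendsto_intros)
  qed
  obtain E where "E > 0" and E: "(\<lambda>n. W i * g n (T - s)) \<longlonglongrightarrow> E"
    using lim[of i] s by (auto simp: \<delta>_def bc axis_def)
  have "(\<lambda>n. W j * g n (T - s)) \<longlonglongrightarrow> 0"
    using lim[of j] s \<open>i \<noteq> j\<close> by (auto simp: \<delta>_def bc axis_def)
  \<comment> \<open>Rescaling by the ratio of the weights turns the signal on edge \<open>j\<close>
    into that on edge \<open>i\<close>, whose limit \<open>E\<close> is positive.\<close>
  then have "(\<lambda>n. W i / W j * (W j * g n (T - s))) \<longlonglongrightarrow> W i / W j * 0"
    by (rule tendsto_mult_left)
  then have "(\<lambda>n. W i * g n (T - s)) \<longlonglongrightarrow> 0"
    using W[of j] by simp
  with E \<open>E > 0\<close> show False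
    using LIMSEQ_unique by fastforce
qed

theorem proposition6p2:
  fixes G :: "('k::finite, 'n::finite) pre_digraph"
    and w :: "real^'n^'k"
    and \<Gamma> :: "real^'m::finite^'k"
    and lam d :: "'n \<Rightarrow> real \<Rightarrow> real"
    and q T :: real
  assumes "verts G = UNIV" and "arcs G = UNIV"
    and "\<And>v. out_arcs G v \<noteq> {}" and "\<And>v. in_arcs G v \<noteq> {}"
    and "\<And>i j. 0 \<le> w $ i $ j \<and> w $ i $ j \<le> 1"
    and "\<And>i. (\<Sum>j\<in>UNIV. w $ i $ j) = 1"
    and "\<And>i j. w $ i $ j = 0 \<longleftrightarrow> outgoing_incidence G $ i $ j = 0"
    and "\<And>j. integrable (lebesgue_on {0..1}) (d j)"
    and "\<And>j x. x \<in> {0..1} \<Longrightarrow> lam j x < 0"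
    and "\<And>j. lam j \<in> Linf 0 1" and "\<And>j. (\<lambda>x. 1 / lam j x) \<in> Linf 0 1"
    and "1 \<le> q" and "0 < T"
    and "approx_controllable G w \<Gamma> lam d q T"
  shows "\<exists>\<C>. finite \<C> \<and> (\<forall>C\<in>\<C>. directed_cycle_graph C) \<and> disjoint_union_of G \<C>"
proof -
  have "wf_digraph G"
    using assms(1) by (simp add: wf_digraph_def)
  moreover have "inj (tail G)"
    using inj_tail_if_approx_controllable[OF assms(7) assms(9) assms(11) _ assms(13,14)] assms(12) by simp
  ultimately show ?thesis
    using bij_tail_head[of G] assms(2-4) by (intro disjoint_union_of_directed_cycles) simp_all
qed

end
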